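(* Let $\Sigma$ be a simplicial fan in $\mathbb{R}^d$ with $n$ rays and ray matrix $U\in\mathbb{R}^{n\times d}$. The hypersurface $\mathcal{A}_\Sigma$ contains each coordinate subspace $\Lambda_J$ for $J\in\Sigma^c$. We have $[\Lambda_J]\in F_{n-1-|J|}(\mathcal{A}_\Sigma)$, where $|J|$ denotes the cardinality of $J$, and ${\rm Adj}_\Sigma\in B(\Sigma)$.
   Context: A simplicial fan $\Sigma$ is a (finite) polyhedral fan whose cones are generated by linearly independent vectors. $\Sigma(k)$ is the set of $k$-dimensional cones, $\sigma(1)$ the set of rays of $\sigma$, $n=|\Sigma(1)|$. A ray matrix $U\in\mathbb{R}^{n\times d}$, assumed of rank $d$, has rows $u_\rho$, $\rho\in\Sigma(1)$, with $u_\rho$ a nonzero generator of $\rho$; $U_\sigma$ is the submatrix with rows indexed by $\sigma(1)$. ${\rm Adj}_\Sigma(x)=\sum_{\sigma\in\Sigma(d)}|\det U_\sigma|\prod_{\rho\notin\sigma(1)}x_\rho$ and $\mathcal{A}_\Sigma=\{x\in\mathbb{P}^{n-1}:{\rm Adj}_\Sigma(x)=0\}$ in complex projective space with homogeneous coordinates $x_\rho$, $\rho\in\Sigma(1)$. $\Sigma^c$ is the set of subsets of $\Sigma(1)$ which are not contained in a cone of $\Sigma$. For $J\subseteq\Sigma(1)$, $\Lambda_J=\{x\in\mathbb{P}^{n-1}:x_\rho=0\text{ for all }\rho\in J\}$. For $\sigma\in\Sigma$, $x^{\hat\sigma}=\prod_{\rho\notin\sigma(1)}x_\rho$, and the irrelevant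 ideal is $B(\Sigma)=\langle x^{\hat\sigma}:\sigma\in\Sigma\rangle\subseteq\mathbb{C}[x_\rho:\rho\in\Sigma(1)]$. $F_k(X)=\{[\Lambda]\in{\rm Gr}(k+1,n):\Lambda\subseteq X\}$ is the (underlying set of the) Fano scheme of $k$-planes of $X\subset\mathbb{P}^{n-1}$, where $\Lambda$ is a $k$-dimensional linear subspace of $\mathbb{P}^{n-1}$ and $[\Lambda]$ its point in the Grassmannian (for $k=-1$, $\Lambda=\emptyset$ and the membership is trivial). *)

theory Defs
  imports "HOL-Analysis.Analysis" "HOL-Library.Poly_Mapping"
begin

section \<open>Fans\<close>

text \<open>The library relation \<open>face_of\<close> also admits the empty face, which is not a face of a cone;
  hence the side condition in the third clause. All other faces of a polyhedron in the sense of
  \<open>face_of\<close> are cut out by supporting hyperplanes (\<open>exposed_face_of_polyhedron\<close>).\<close>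

definition polyhedral_fan :: "(real^'d) set set \<Rightarrow> bool" where
  "polyhedral_fan \<Sigma> \<longleftrightarrow>
     finite \<Sigma> \<and>
     (\<forall>\<sigma>\<in>\<Sigma>. polyhedron \<sigma> \<and> convex_cone \<sigma>) \<and>
     (\<forall>\<sigma>\<in>\<Sigma>. \<forall>\<tau>. \<tau> face_of \<sigma> \<and> \<tau> \<noteq> {} \<longrightarrow> \<tau> \<in> \<Sigma>) \<and>
     (\<forall>\<sigma>\<in>\<Sigma>. \<forall>\<tau>\<in>\<Sigma>. (\<sigma> \<inter> \<tau>) face_of \<sigma> \<and> (\<sigma> \<inter> \<tau>) face_of \<tau>)"

definition simplicial_fan :: "(real^'d) set set \<Rightarrow> bool" where
  "simplicial_fan \<Sigma> \<longleftrightarrow>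
     polyhedral_fan \<Sigma> \<and> (\<forall>\<sigma>\<in>\<Sigma>. \<exists>S. independent S \<and> \<sigma> = convex_cone hull S)"

definition fan_cones :: "(real^'d) set set \<Rightarrow> nat \<Rightarrow> (real^'d) set set" where
  "fan_cones \<Sigma> k = {\<sigma>\<in>\<Sigma>. dim \<sigma> = k}"

definition rays_of_cone :: "(real^'d) set \<Rightarrow> (real^'d) set set" where
  "rays_of_cone \<sigma> = {\<rho>. \<rho> face_of \<sigma> \<and> dim \<rho> = 1}"

text \<open>The \<open>n\<close> rays are indexed by the type \<open>'n\<close>, through the rows of the ray matrix: the
  index \<open>i\<close> stands for the ray generated by the \<open>i\<close>-th row.\<close>

definition row_ray :: "real^'d^'n \<Rightarrow> 'n \<Rightarrow> (real^'d) set" where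
  "row_ray U i = convex_cone hull {U $ i}"

definition ray_matrix :: "(real^'d) set set \<Rightarrow> real^'d^'n \<Rightarrow> bool" where
  "ray_matrix \<Sigma> U \<longleftrightarrow>
     (\<forall>i. U $ i \<noteq> 0) \<and> bij_betw (row_ray U) UNIV (fan_cones \<Sigma> 1) \<and> rank U = CARD('d)"

definition ray_indices :: "real^'d^'n \<Rightarrow> (real^'d) set \<Rightarrow> 'n set" where
  "ray_indices U \<sigma> = {i. row_ray U i \<in> rays_of_cone \<sigma>}"

definition fan_nonfaces :: "(real^'d) set set \<Rightarrow> real^'d^'n \<Rightarrow> 'n set set" where
  "fan_nonfaces \<Sigma> U = {J. \<not> (\<exists>\<sigma>\<in>\<Sigma>. J \<subseteq> ray_indices U \<sigma>)}"

text \<open>The absolute value of the determinant of the square submatrix of \<open>U\<close> with rows indexed by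
  \<open>I\<close>, where \<open>I\<close> has as many elements as \<open>U\<close> has columns. The rows are put into an arbitrary
  order, on which the value does not depend.\<close>

definition abs_minor :: "real^'d^'n \<Rightarrow> 'n set \<Rightarrow> real" where
  "abs_minor U I = \<bar>det (\<chi> j. U $ ((SOME e. bij_betw e (UNIV :: 'd set) I) j))\<bar>"

lemma abs_minor_eq:
  fixes U :: "real^'d^'n"
  assumes f: "bij_betw f (UNIV :: 'd set) I"
  shows "abs_minor U I = \<bar>det (\<chi> j. U $ f j)\<bar>"
proof -
  define e where "e = (SOME e. bij_betw e (UNIV :: 'd set) I)"
  have e: "bij_betw e UNIV I"
    unfolding e_def by (rule someI[of "\<lambda>e. bij_betw e UNIV I", OF f])
  define p where "p = inv_into UNIV e \<circ> f"
  have "bij_betw p UNIV UNIV"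
    unfolding p_def using bij_betw_trans[OF f bij_betw_inv_into[OF e]] .
  then have p: "p permutes UNIV"
    by (simp add: permutes_def bij_iff)
  have ep: "e (p j) = f j" for j
    using f e unfolding p_def by (metis UNIV_I bij_betwE bij_betw_inv_into_right comp_apply)
  have "det (\<chi> i. (\<chi> j. U $ e j) $ p i) = of_int (sign p) * det (\<chi> j. U $ e j)"
    by (rule det_permute_rows[OF p])
  moreover have "\<bar>of_int (sign p) :: real\<bar> = 1"
    by (simp add: sign_def)
  ultimately show ?thesis
    by (simp add: ep abs_mult abs_minor_def flip: e_def)
qed


section \<open>Polynomials\<close>

text \<open>The polynomial ring over \<open>\<complex>\<close> in the variables indexed by \<open>'n\<close>: finitely supported maps
  from exponent vectors to coefficients, with the convolution product.\<close>

type_synonym 'n cpoly = "('n \<Rightarrow>\<^sub>0 nat) \<Rightarrow>\<^sub>0 complex"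

definition cvar :: "'n \<Rightarrow> 'n cpoly" where
  "cvar i = Poly_Mapping.single (Poly_Mapping.single i 1) 1"

definition cconst :: "complex \<Rightarrow> 'n cpoly" where
  "cconst c = Poly_Mapping.single 0 c"

definition cpoly_eval :: "'n::finite cpoly \<Rightarrow> complex^'n \<Rightarrow> complex" where
  "cpoly_eval p x =
     (\<Sum>m\<in>Poly_Mapping.keys p.
        Poly_Mapping.lookup p m * (\<Prod>i\<in>UNIV. x $ i ^ Poly_Mapping.lookup m i))"

lemma module_ring_over_itself: "module ((*) :: 'a::comm_ring_1 \<Rightarrow> 'a \<Rightarrow> 'a)"
  by unfold_locales (simp_all add: algebra_simps)

definition generated_ideal :: "'a::comm_ring_1 set \<Rightarrow> 'a set" where
  "generated_ideal S = module.span (*) S"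

definition cone_monomial :: "real^'d^'n \<Rightarrow> (real^'d) set \<Rightarrow> 'n::finite cpoly" where
  "cone_monomial U \<sigma> = (\<Prod>i\<in>UNIV - ray_indices U \<sigma>. cvar i)"

definition adjoint_poly :: "(real^'d) set set \<Rightarrow> real^'d^'n \<Rightarrow> 'n::finite cpoly" where
  "adjoint_poly \<Sigma> U =
     (\<Sum>\<sigma>\<in>fan_cones \<Sigma> CARD('d).
        cconst (complex_of_real (abs_minor U (ray_indices U \<sigma>))) * cone_monomial U \<sigma>)"

definition irrelevant_ideal :: "(real^'d) set set \<Rightarrow> real^'d^'n \<Rightarrow> 'n::finite cpoly set" where
  "irrelevant_ideal \<Sigma> U = generated_ideal (cone_monomial U ` \<Sigma>)"


section \<open>Complex projective space\<close>

text \<open>A point of projective space is a line through the origin; its nonzero vectors are its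
  homogeneous coordinate vectors.\<close>

definition proj_space :: "(complex^'n) set set" where
  "proj_space = {L. vec.subspace L \<and> vec.dim L = 1}"

definition coord_subspace :: "'n set \<Rightarrow> (complex^'n) set set" where
  "coord_subspace J = {L\<in>proj_space. \<forall>x\<in>L - {0}. \<forall>i\<in>J. x $ i = 0}"

definition adjoint_hypersurface ::
    "(real^'d) set set \<Rightarrow> real^'d^'n \<Rightarrow> (complex^'n::finite) set set" where
  "adjoint_hypersurface \<Sigma> U =
     {L\<in>proj_space. \<forall>x\<in>L - {0}. cpoly_eval (adjoint_poly \<Sigma> U) x = 0}"

text \<open>Points of the Grassmannian are linear subspaces \<open>W\<close> of the coordinate space, and
  \<open>projectivization W\<close> is the corresponding linear subspace of projective space. In the other
  direction, \<open>grass_point \<Lambda>\<close> is the point \<open>[\<Lambda>]\<close> of the Grassmannian, i.e. the union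
  of the lines in \<open>\<Lambda>\<close>; adding the origin matters only for empty \<open>\<Lambda>\<close>. Dimensions are
  integers so that the empty subspace can have dimension \<open>-1\<close>.\<close>

definition grassmannian :: "int \<Rightarrow> (complex^'n) set set" where
  "grassmannian r = {W. vec.subspace W \<and> int (vec.dim W) = r}"

definition projectivization :: "(complex^'n) set \<Rightarrow> (complex^'n) set set" where
  "projectivization W = {L\<in>proj_space. L \<subseteq> W}"

definition grass_point :: "(complex^'n) set set \<Rightarrow> (complex^'n) set" where
  "grass_point \<Lambda> = insert 0 (\<Union>\<Lambda>)"

definition fano :: "int \<Rightarrow> (complex^'n) set set \<Rightarrow> (complex^'n) set set" where
  "fano k X = {W\<in>grassmannian (k + 1). projectivization W \<subseteq> X}"

lemma grass_point_projectivization: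
  fixes W :: "(complex^'n) set"
  assumes W: "vec.subspace W"
  shows "grass_point (projectivization W) = W"
proof
  show "grass_point (projectivization W) \<subseteq> W"
    using vec.subspace_0[OF W] by (auto simp: grass_point_def projectivization_def)
  show "W \<subseteq> grass_point (projectivization W)"
  proof
    fix x assume x: "x \<in> W"
    show "x \<in> grass_point (projectivization W)"
    proof (cases "x = 0")
      case False
      have "vec.span {x} \<subseteq> W"
        using W x by (simp add: vec.span_minimal)
      moreover have "vec.dim (vec.span {x}) = 1"
        using False vec.dim_eq_card_independent[of "{x}"] by (simp add: vec.dim_span)
      ultimately have "vec.span {x} \<in> projectivization W"
        by (simp add: projectivization_def proj_space_def)
      then show ?thesis
        using vec.span_base[of x "{x}"] by (auto simp: grass_point_def)
    qed (simp add: grass_point_def)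
  qed
qed

end

theory Submission
  imports Defs
begin

text \<open>If \<open>J\<close> is not contained in a cone of the fan, then each monomial of the adjoint
  contains a variable indexed by \<open>J\<close>, and so vanishes wherever all these variables do.\<close>

text \<open>Exponent vectors outside the support have coefficient 0. A larger index set lets
  polynomials with different supports, such as \<open>p\<close>, \<open>q\<close> and
  \<open>p + q\<close>, be evaluated over a common one.\<close>

lemma cpoly_eval_superset:
  assumes "finite A" and "Poly_Mapping.keys p \<subseteq> A"
  shows "cpoly_eval p x =
    (\<Sum>m\<in>A. Poly_Mapping.lookup p m * (\<Prod>i\<in>UNIV. x $ i ^ Poly_Mapping.lookup m i))"
  unfolding cpoly_eval_def
  by (rule sum.mono_neutral_left) (use assms in \<open>auto simp: in_keys_iff\<close>)

lemma cpoly_eval_zero [simp]: "cpoly_eval 0 x = 0"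
  by (simp add: cpoly_eval_def)

lemma cpoly_eval_add: "cpoly_eval (p + q) x = cpoly_eval p x + cpoly_eval q x"
proof -
  let ?A = "Poly_Mapping.keys p \<union> Poly_Mapping.keys q"
  have "Poly_Mapping.keys (p + q) \<subseteq> ?A"
    by (rule Poly_Mapping.keys_add)
  then show ?thesis
    by (simp add: cpoly_eval_superset[of ?A] lookup_add algebra_simps sum.distrib)
qed

lemma cpoly_eval_sum: "cpoly_eval (\<Sum>a\<in>A. f a) x = (\<Sum>a\<in>A. cpoly_eval (f a) x)"
  by (induction A rule: infinite_finite_induct) (simp_all add: cpoly_eval_add)

lemma cpoly_eval_single:
  "cpoly_eval (Poly_Mapping.single m c) x = c * (\<Prod>i\<in>UNIV. x $ i ^ Poly_Mapping.lookup m i)"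
  \<comment> \<open>The support is empty when \<open>c = 0\<close>; summing over \<open>{m}\<close>
    covers both cases.\<close>
  by (subst cpoly_eval_superset[of "{m}"]) auto

lemma prod_cvar:
  "(\<Prod>i\<in>A. cvar i) = Poly_Mapping.single (\<Sum>i\<in>A. Poly_Mapping.single i 1) 1"
  by (induction A rule: infinite_finite_induct) (simp_all add: cvar_def mult_single)

lemma cpoly_eval_cconst_mult_prod_cvar:
  "cpoly_eval (cconst c * (\<Prod>i\<in>A. cvar i)) x = c * (\<Prod>i\<in>A. x $ i)"
proof -
  \<comment> \<open>The exponent vector of a squarefree monomial is the indicator function of its
    set of variables.\<close>
  have "Poly_Mapping.lookup (\<Sum>i\<in>A. Poly_Mapping.single i (1::nat)) j = (if j \<in> A then 1 else 0)" for j
    by (simp add: lookup_sum lookup_single when_def)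
  moreover have "(\<Prod>i\<in>A. x $ i) = (\<Prod>i\<in>UNIV. x $ i ^ (if i \<in> A then 1 else 0))"
    by (rule prod.mono_neutral_cong_left) auto
  ultimately show ?thesis
    by (simp add: prod_cvar cconst_def mult_single cpoly_eval_single)
qed

lemma cpoly_eval_adjoint_poly:
  fixes U :: "real^'d^'n"
  shows
  "cpoly_eval (adjoint_poly \<Sigma> U) x =
     (\<Sum>\<sigma>\<in>fan_cones \<Sigma> CARD('d).
        complex_of_real (abs_minor U (ray_indices U \<sigma>)) * (\<Prod>i\<in>UNIV - ray_indices U \<sigma>. x $ i))"
  by (simp add: adjoint_poly_def cone_monomial_def cpoly_eval_sum cpoly_eval_cconst_mult_prod_cvar)

lemma cpoly_eval_adjoint_poly_nonface:
  fixes U :: "real^'d^'n"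
  assumes "J \<in> fan_nonfaces \<Sigma> U" and "\<And>i. i \<in> J \<Longrightarrow> x $ i = 0"
  shows "cpoly_eval (adjoint_poly \<Sigma> U) x = 0"
  unfolding cpoly_eval_adjoint_poly
proof (rule sum.neutral, rule ballI)
  fix \<sigma> assume "\<sigma> \<in> fan_cones \<Sigma> CARD('d)"
  \<comment> \<open>Since \<sigma> lies in \<Sigma>, it cannot contain all of \<open>J\<close>; an
    index of \<open>J\<close> that it misses gives a vanishing factor.\<close>
  with assms obtain i where "i \<in> UNIV - ray_indices U \<sigma>" "x $ i = 0"
    by (auto simp: fan_nonfaces_def fan_cones_def)
  then show "complex_of_real (abs_minor U (ray_indices U \<sigma>)) *
      (\<Prod>i\<in>UNIV - ray_indices U \<sigma>. x $ i) = 0"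
    by (auto intro!: prod_zero)
qed

text \<open>The adjoint is by construction a combination, with constant coefficients, of those
  generators of the ideal that belong to full-dimensional cones.\<close>

lemma adjoint_poly_in_irrelevant_ideal: "adjoint_poly \<Sigma> U \<in> irrelevant_ideal \<Sigma> U"
proof -
  interpret module "(*) :: 'n::finite cpoly \<Rightarrow> _"
    by (rule module_ring_over_itself)
  show ?thesis
    unfolding adjoint_poly_def irrelevant_ideal_def generated_ideal_def
    by (intro span_sum span_scale span_base) (auto simp: fan_cones_def)
qed

text \<open>The two sides treat the origin of a line differently, but it satisfies the coordinate
  equations anyway.\<close>

lemma coord_subspace_eq_projectivization:
  "coord_subspace J = projectivization {x. \<forall>i\<in>J. x $ i = 0}"
  unfolding coord_subspace_def projectivization_def
  by (auto simp: subset_iff)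

lemma grass_point_coord_subspace:
  "grass_point (coord_subspace J) = {x. \<forall>i\<in>J. x $ i = 0}"
  unfolding coord_subspace_eq_projectivization
  by (rule grass_point_projectivization) (auto simp: vec.subspace_def)

text \<open>The coordinates outside \<open>J\<close> are free, so the linear dimension is n - |J|,
  one more than the projective dimension.\<close>

lemma grass_point_coord_subspace_in_grassmannian:
  fixes J :: "'n::finite set"
  shows "grass_point (coord_subspace J) \<in> grassmannian (int CARD('n) - int (card J))"
proof -
  \<comment> \<open>The inequality keeps the truncated subtraction of naturals in agreement with the
    one of integers.\<close>
  have "card (- J) = CARD('n) - card J" and "card J \<le> CARD('n)"
    by (simp_all add: Compl_eq_Diff_UNIV card_Diff_subset card_mono)
  moreover have "vec.dim {x :: complex^'n. \<forall>i\<in>J. x $ i = 0} = card (- J)"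
    using dim_substandard_cart[of "- J", where 'a = complex] by (simp add: Ball_def)
  ultimately show ?thesis
    unfolding grass_point_coord_subspace grassmannian_def
    by (auto simp: vec.subspace_def)
qed

theorem proposition5p3:
  fixes \<Sigma> :: "(real^'d) set set" and U :: "real^'d^'n"
  assumes "simplicial_fan \<Sigma>" and "ray_matrix \<Sigma> U"
  shows "(\<forall>J\<in>fan_nonfaces \<Sigma> U.
            coord_subspace J \<subseteq> adjoint_hypersurface \<Sigma> U \<and>
            grass_point (coord_subspace J)
              \<in> fano (int CARD('n) - 1 - int (card J)) (adjoint_hypersurface \<Sigma> U)) \<and>
         adjoint_poly \<Sigma> U \<in> irrelevant_ideal \<Sigma> U"
proof (intro conjI ballI)
  fix J assume J: "J \<in> fan_nonfaces \<Sigma> U"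
  show sub: "coord_subspace J \<subseteq> adjoint_hypersurface \<Sigma> U"
    using cpoly_eval_adjoint_poly_nonface[OF J]
    by (auto simp: coord_subspace_def adjoint_hypersurface_def)
  \<comment> \<open>Membership in \<open>fano\<close> is tested on the projectivization of a
    Grassmannian point, so the inclusion \<open>sub\<close> has to be carried over to it.\<close>
  have "projectivization (grass_point (coord_subspace J)) = coord_subspace J"
    unfolding grass_point_coord_subspace by (rule coord_subspace_eq_projectivization[symmetric])
  with sub grass_point_coord_subspace_in_grassmannian[of J]
  show "grass_point (coord_subspace J)
          \<in> fano (int CARD('n) - 1 - int (card J)) (adjoint_hypersurface \<Sigma> U)"
    by (simp add: fano_def)
qed (rule adjoint_poly_in_irrelevant_ideal)

end
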